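(* Each of the numbers $41, 43, 59, 67, 82, 83, 85, 86, 89, 91, 97$ is an $ndh$-number, i.e. none of them can be written as $h-k$ with $h,k$ harmonic numbers.
   Context: A harmonic number is a positive integer of the form $2^a3^b$ with $a,b\ge 0$ integers (so $1$ is harmonic). A positive integer is an $ndh$-number if it cannot be written as a difference $h-k$ of two harmonic numbers $h,k$. *)

theory Defs
  imports Main
begin

definition harmonic_number :: "nat \<Rightarrow> bool" where
  "harmonic_number n \<longleftrightarrow> (\<exists>a b. n = 2 ^ a * 3 ^ b)"

(* The difference is taken in int, since subtraction on nat truncates. *)
definition ndh_number :: "nat \<Rightarrow> bool" where
  "ndh_number n \<longleftrightarrow> n > 0 \<and>
     \<not> (\<exists>h k. harmonic_number h \<and> harmonic_number k \<and> int n = int h - int k)"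

end

theory Submission
  imports Defs
begin

text \<open>Suppose \<open>n = h - k\<close> with \<open>h, k\<close> harmonic. If \<open>n\<close> is coprime to 6, then \<open>h\<close> and
  \<open>k\<close> are coprime, so \<open>k = 1\<close> or one of them is a power of 2 and the other a power of 3. The
  first case is ruled out by a factor of \<open>n + 1\<close> coprime to 6, the second modulo
  \<open>240 = 2^8 - 2^4 = 3^5 - 3\<close>, where there are only eight residues of powers of 2 and five of
  powers of 3. If \<open>n\<close> is even, then either \<open>h\<close> and \<open>k\<close> can be halved or both are powers of 3,
  which for \<open>82\<close> and \<open>86\<close> is again impossible modulo 240.\<close>

lemma harmonic_number_power_mult [simp]: "harmonic_number (2 ^ a * 3 ^ b)"
  by (auto simp: harmonic_number_def)

lemma harmonic_number_power2 [simp]: "harmonic_number (2 ^ a)"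
  using harmonic_number_power_mult[of a 0] by simp

lemma harmonic_number_power3 [simp]: "harmonic_number (3 ^ b)"
  using harmonic_number_power_mult[of 0 b] by simp

lemma harmonic_number_1 [simp]: "harmonic_number 1"
  using harmonic_number_power2[of 0] by simp

lemma harmonic_number_pos: "harmonic_number h \<Longrightarrow> h > 0"
  by (auto simp: harmonic_number_def)

lemma odd_harmonic_numberE:
  assumes "harmonic_number h" "odd h"
  obtains b where "h = 3 ^ b"
  using assms by (auto simp: harmonic_number_def)

lemma harmonic_number_double_iff: "harmonic_number (2 * h) \<longleftrightarrow> harmonic_number h"
proof
  assume "harmonic_number (2 * h)"
  then obtain a b where h: "2 * h = 2 ^ a * 3 ^ b"
    by (auto simp: harmonic_number_def)
  then have "even (2 ^ a * 3 ^ b :: nat)"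
    by (metis dvd_triv_left)
  then obtain a' where "a = Suc a'"
    by (cases a) auto
  with h have "h = 2 ^ a' * 3 ^ b"
    by simp
  then show "harmonic_number h"
    by simp
next
  assume "harmonic_number h"
  then obtain a b where "2 * h = 2 ^ Suc a * 3 ^ b"
    by (auto simp: harmonic_number_def)
  then show "harmonic_number (2 * h)"
    by (metis harmonic_number_power_mult)
qed

lemma coprime_harmonic_number:
  assumes "harmonic_number h" "coprime n 6"
  shows "coprime n h"
proof -
  have "coprime n (2 * 3)"
    using assms(2) by simp
  then have "coprime n 2" "coprime n 3"
    unfolding coprime_mult_right_iff by simp_all
  then show ?thesis
    using assms(1) by (auto simp: harmonic_number_def)
qed

lemma coprime_harmonic_numbers_cases:
  assumes "harmonic_number h" "harmonic_number k" "coprime h k"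
  obtains "h = 1" | "k = 1" | a b where "h = 2 ^ a" "k = 3 ^ b" | a b where "h = 3 ^ b" "k = 2 ^ a"
proof -
  obtain a b c d where hk: "h = 2 ^ a * 3 ^ b" "k = 2 ^ c * 3 ^ d"
    using assms(1,2) by (auto simp: harmonic_number_def)
  have "a = 0 \<or> c = 0" "b = 0 \<or> d = 0"
    using assms(3) by (auto simp: hk)
  then show thesis
    using that by (auto simp: hk)
qed

lemma ndh_number_iff:
  "ndh_number n \<longleftrightarrow> n > 0 \<and> (\<forall>h k. harmonic_number h \<longrightarrow> harmonic_number k \<longrightarrow> h \<noteq> n + k)"
proof -
  have "int n = int h - int k \<longleftrightarrow> h = n + k" for h k
    by linarith
  then show ?thesis
    by (auto simp: ndh_number_def)
qed

lemma ndh_number_coprime_6_iff: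
  assumes "coprime n 6"
  shows "ndh_number n \<longleftrightarrow>
    \<not> harmonic_number (n + 1) \<and> (\<forall>a b. 2 ^ a \<noteq> n + 3 ^ b) \<and> (\<forall>a b. 3 ^ b \<noteq> n + 2 ^ a)"
    (is "_ \<longleftrightarrow> ?no_special_difference")
proof
  assume "ndh_number n"
  then have "h \<noteq> n + k" if "harmonic_number h" "harmonic_number k" for h k
    using that by (simp add: ndh_number_iff)
  then show ?no_special_difference
    using harmonic_number_1 harmonic_number_power2 harmonic_number_power3 by blast
next
  assume no_special_difference: ?no_special_difference
  have "n > 0"
    using assms by (auto intro: gr0I)
  moreover have "h \<noteq> n + k" if h: "harmonic_number h" and k: "harmonic_number k" for h k
  proof
    assume difference: "h = n + k"
    have "coprime n k"
      using k assms by (rule coprime_harmonic_number)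
    then have "coprime h k"
      by (simp add: difference coprime_iff_gcd_eq_1)
    with h k show False
    proof (cases rule: coprime_harmonic_numbers_cases)
      case 1
      then show False
        using difference \<open>n > 0\<close> harmonic_number_pos[OF k] by simp
    qed (use h difference no_special_difference in metis)+
  qed
  ultimately show "ndh_number n"
    by (simp add: ndh_number_iff)
qed

lemma harmonic_difference_double_cases:
  assumes h: "harmonic_number h" and k: "harmonic_number k" and difference: "h = 2 * n + k"
  obtains b d where "h = 3 ^ b" "k = 3 ^ d"
    | h' k' where "harmonic_number h'" "harmonic_number k'" "h' = n + k'"
proof (cases "even k")
  case True
  then obtain k' where k': "k = 2 * k'" ..
  then have "h = 2 * (n + k')"
    using difference by simp
  then have "harmonic_number (n + k')" "harmonic_number k'"
    using h k k' by (simp_all only: harmonic_number_double_iff)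
  then show thesis
    using that by blast
next
  case False
  then have "odd h"
    using difference by simp
  with False show thesis
    using h k that by (metis odd_harmonic_numberE)
qed

lemma ndh_number_double_iff:
  "ndh_number (2 * n) \<longleftrightarrow> ndh_number n \<and> (\<forall>b d. 3 ^ b \<noteq> 2 * n + 3 ^ d)"
proof (intro iffI conjI allI)
  assume double: "ndh_number (2 * n)"
  show "3 ^ b \<noteq> 2 * n + 3 ^ d" for b d
    using double by (simp add: ndh_number_iff)
  have "h \<noteq> n + k" if "harmonic_number h" "harmonic_number k" for h k
  proof -
    have "2 * h \<noteq> 2 * n + 2 * k"
      using double that by (simp add: ndh_number_iff harmonic_number_double_iff)
    then show ?thesis
      by simp
  qed
  then show "ndh_number n"
    using double by (simp add: ndh_number_iff)
next
  assume half: "ndh_number n \<and> (\<forall>b d. 3 ^ b \<noteq> 2 * n + 3 ^ d)"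
  have "h \<noteq> 2 * n + k" if "harmonic_number h" "harmonic_number k" for h k
  proof
    assume "h = 2 * n + k"
    with that show False
      by (cases rule: harmonic_difference_double_cases)
        (use half \<open>h = 2 * n + k\<close> ndh_number_iff in metis)+
  qed
  then show "ndh_number (2 * n)"
    using half by (simp add: ndh_number_iff)
qed

lemma power_mod_mem:
  fixes q m :: "'a :: euclidean_semiring_cancel"
  assumes "1 mod m \<in> R" "\<And>r. r \<in> R \<Longrightarrow> q * r mod m \<in> R"
  shows "q ^ i mod m \<in> R"
proof (induction i)
  case 0
  then show ?case
    using assms(1) by simp
next
  case (Suc i)
  then have "q * (q ^ i mod m) mod m \<in> R"
    by (rule assms(2))
  then show ?case
    by (simp add: mod_mult_right_eq)
qed

lemma power2_mod_240: "(2 :: nat) ^ a mod 240 \<in> {1, 2, 4, 8, 16, 32, 64, 128}"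
  by (rule power_mod_mem) auto

lemma power3_mod_240: "(3 :: nat) ^ b mod 240 \<in> {1, 3, 9, 27, 81}"
  by (rule power_mod_mem) auto

lemma neq_add_by_residues:
  fixes x y n m :: "'a :: euclidean_semiring_cancel"
  assumes "x mod m \<in> R" "y mod m \<in> S" "\<forall>s \<in> S. (n + s) mod m \<notin> R"
  shows "x \<noteq> n + y"
proof
  assume "x = n + y"
  then have "x mod m = (n + y mod m) mod m"
    by (simp add: mod_add_right_eq)
  then show False
    using assms by metis
qed

lemma ndh_numbers_coprime_6: "\<forall>n \<in> {41, 43, 59, 67, 83, 85, 89, 91, 97}. ndh_number n"
proof
  fix n :: nat
  assume n: "n \<in> {41, 43, 59, 67, 83, 85, 89, 91, 97}"
  then have "coprime n 6"
    by (elim insertE emptyE; simp add: coprime_iff_gcd_eq_1 gcd_non_0_nat)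
  moreover have "\<not> harmonic_number (n + 1)"
  proof -
    have "\<exists>p \<in> {5, 7, 11, 17, 23, 43}. p dvd n + 1"
      using n by auto
    moreover have "\<forall>p \<in> {5, 7, 11, 17, 23, 43 :: nat}. p \<noteq> 1 \<and> coprime p 6"
      by (simp add: coprime_iff_gcd_eq_1 gcd_non_0_nat)
    ultimately obtain p where "p dvd n + 1" "p \<noteq> 1" "coprime p 6"
      by blast
    then show ?thesis
      by (metis coprime_harmonic_number coprime_absorb_left nat_dvd_1_iff_1)
  qed
  moreover have "2 ^ a \<noteq> n + 3 ^ b" for a b
    by (rule neq_add_by_residues[OF power2_mod_240 power3_mod_240])
      (use n in \<open>elim insertE emptyE; simp\<close>)
  moreover have "3 ^ b \<noteq> n + 2 ^ a" for a b
    by (rule neq_add_by_residues[OF power3_mod_240 power2_mod_240])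
      (use n in \<open>elim insertE emptyE; simp\<close>)
  ultimately show "ndh_number n"
    by (simp add: ndh_number_coprime_6_iff)
qed

theorem theorem2p2:
  shows "\<forall>n \<in> {41, 43, 59, 67, 82, 83, 85, 86, 89, 91, 97}. ndh_number n"
proof -
  have "ndh_number (2 * n)" if n: "n \<in> {41, 43}" for n
  proof -
    have "3 ^ b \<noteq> 2 * n + 3 ^ d" for b d
      by (rule neq_add_by_residues[OF power3_mod_240 power3_mod_240])
        (use n in \<open>elim insertE emptyE; simp\<close>)
    then show ?thesis
      using n ndh_numbers_coprime_6 by (auto simp: ndh_number_double_iff)
  qed
  from this[of 41] this[of 43] show ?thesis
    using ndh_numbers_coprime_6 by simp
qed

end
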